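(* Let $\mathrm{CNOT12}=|0000\rangle+|1010\rangle+|1101\rangle+|0111\rangle$ and $\mathrm{CNOT1}=|0000\rangle+|0110\rangle+|1011\rangle+|1101\rangle$ (4-arity gates), and let $T=\langle100|+\langle010|+\langle001|+\langle111|$ and $U=\langle000|+\langle010|+\langle101|$ (3-arity "bridge" cogates). There exist invertible matrices $A,B,C,D,E,F,G,H,I,J\in\mathbb{C}^{2\times2}$ such that the chain CNOT12-CNOT1 linked by the cogates $T$ and $U$ is Pfaffian, i.e. such that simultaneously: - CNOT12 is Pfaffian under $A\otimes B\otimes C\otimes D$; - CNOT1 is Pfaffian under $G\otimes H\otimes I\otimes J$; - $T$ is Pfaffian under $D^{-1}\otimes E^{-1}\otimes G^{-1}$; - $U$ is Pfaffian under $C^{-1}\otimes F^{-1}\otimes H^{-1}$.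
   Context: Let $V=\mathbb{C}^2$ with basis $|0\rangle,|1\rangle$ and dual basis $\langle0|,\langle1|$. An $n$-arity gate is an element of $V^{\otimes n}$, and an $n$-arity cogate is an element of $(V^* )^{\otimes n}$. For $S\subseteq[n]=\{1,\dots,n\}$, $|S\rangle$ and $\langle S|$ denote the basis ket and bra whose bitstring is the indicator of $S$, and $S^c=[n]\setminus S$. Rows and columns of $2\times2$ matrices are indexed by $0,1$. A matrix $M$ acts on kets by $M|j\rangle=M_{0j}|0\rangle+M_{1j}|1\rangle$ and on bras by $M\langle j|=M_{j0}\langle0|+M_{j1}\langle1|$ (row-vector multiplication). For an $n\times n$ complex skew-symmetric matrix $\Xi$ put $\mathrm{sPf}(\Xi)=\sum_{S\subseteq[n]}\mathrm{Pf}(\Xi|_S)|S\rangle$ and $\mathrm{sPf}^*(\Xi)=\sum_{S\subseteq[n]}\mathrm{Pf}(\Xi|_{S^c})\langle S|$, where $\Xi|_S$ is the submatrix with rows and columns in $S$, and the Pfaffian $\mathrm{Pf}$ is $1$ for the empty matrix and $0$ for odd size. An $n$-arity gate $X$ is Pfaffian under $M_1\otimes\cdots\otimes M_n$ if $(M_1\otimes\cdots\otimes M_n)X=\alpha\,\mathrm{sPf}(\Xi)$ for some $\alpha\in\mathbb{C}$ and skew-symmetric $\Xi\in\mathbb{C}^{n\times n}$. An $n$-arity cogate $X$ is Pfaffian under $M_1^{-1}\otimes\cdots\otimes M_n^{-1}$ if $(M_1^{-1}\otimes\cdots\otimes M_n^{-1})X=\beta\,\mathrm{sPf}^*(\Theta)$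 for some $\beta\in\mathbb{C}$ and skew-symmetric $\Theta\in\mathbb{C}^{n\times n}$. In the network, $T$ connects wire 4 of CNOT12 (basis $D$) to wire 1 of CNOT1 (basis $G$), $U$ connects wire 3 of CNOT12 (basis $C$) to wire 2 of CNOT1 (basis $H$), and the middle wires of $T$ and $U$ (bases $E$, $F$) are dangling; an edge with change of basis $M$ applies $M$ on the gate side and $M^{-1}$ on the cogate side. *)

theory Defs
  imports
    "HOL-Analysis.Analysis"
    "HOL-Combinatorics.Permutations"
    "Jordan_Normal_Form.DL_Submatrix"
begin

no_notation Matrix.vec_index (infixl "$" 100)

text \<open>
  Elements of the \<open>n\<close>-fold tensor powers of \<open>V\<close> and of its dual are given by their coordinates:
  the value at a bitstring is the coefficient of the corresponding basis ket or bra, and it is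
  zero at bitstrings whose length is not \<open>n\<close>. Bits are the elements of the two-element type
  \<^typ>\<open>2\<close>, which also indexes the rows and columns of the changes of basis.
  Tensor positions, and rows and columns of the skew-symmetric matrices, are numbered
  from \<open>0\<close> to \<open>n - 1\<close>.
\<close>

type_synonym gate = "2 list \<Rightarrow> complex"
type_synonym cogate = "2 list \<Rightarrow> complex"

definition has_arity :: "nat \<Rightarrow> (2 list \<Rightarrow> complex) \<Rightarrow> bool" where
  "has_arity n X \<longleftrightarrow> (\<forall>w. length w \<noteq> n \<longrightarrow> X w = 0)"

definition ket :: "2 list \<Rightarrow> gate" where
  "ket v = (\<lambda>w. if w = v then 1 else 0)"

definition bra :: "2 list \<Rightarrow> cogate" where
  "bra v = (\<lambda>w. if w = v then 1 else 0)"

definition indicator_bits :: "nat \<Rightarrow> nat set \<Rightarrow> 2 list" where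
  "indicator_bits n S = map (\<lambda>i. if i \<in> S then 1 else 0) [0..<n]"

text \<open>
  On a basis ket, \<open>M\<close> sends \<open>v\<close> to the combination of the \<open>w\<close> with coefficients \<open>M $ w $ v\<close>
  (column \<open>v\<close>); on a basis bra, it sends \<open>v\<close> to the combination of the \<open>w\<close> with coefficients
  \<open>M $ v $ w\<close> (row \<open>v\<close>). The list \<open>Ms\<close> stands for the tensor product of its entries.
\<close>

definition gate_action :: "(complex^2^2) list \<Rightarrow> gate \<Rightarrow> gate" where
  "gate_action Ms X = (\<lambda>w. if length w = length Ms
     then \<Sum>v | length v = length Ms. (\<Prod>i<length Ms. (Ms ! i) $ (w ! i) $ (v ! i)) * X v
     else 0)"

definition cogate_action :: "(complex^2^2) list \<Rightarrow> cogate \<Rightarrow> cogate" where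
  "cogate_action Ms X = (\<lambda>w. if length w = length Ms
     then \<Sum>v | length v = length Ms. (\<Prod>i<length Ms. (Ms ! i) $ (v ! i) $ (w ! i)) * X v
     else 0)"

definition skew_symmetric :: "complex mat \<Rightarrow> bool" where
  "skew_symmetric A \<longleftrightarrow> square_mat A \<and> transpose_mat A = - A"

text \<open>
  The sum over all permutations counts every perfect matching \<open>2^m * m!\<close> times, where
  \<open>2 * m\<close> is the size of the matrix.
\<close>

definition pfaffian :: "complex mat \<Rightarrow> complex" where
  "pfaffian A = (let n = dim_row A; m = n div 2 in
     if even n
     then (\<Sum>p | p permutes {..<n}. of_int (sign p) * (\<Prod>k<m. A $$ (p (2 * k), p (2 * k + 1))))
            / (2 ^ m * fact m)
     else 0)"

definition sPf :: "complex mat \<Rightarrow> gate" where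
  "sPf \<Xi> = (let n = dim_row \<Xi> in
     (\<lambda>w. \<Sum>S\<in>Pow {..<n}. pfaffian (submatrix \<Xi> S S) * ket (indicator_bits n S) w))"

definition sPf_dual :: "complex mat \<Rightarrow> cogate" where
  "sPf_dual \<Theta> = (let n = dim_row \<Theta> in
     (\<lambda>w. \<Sum>S\<in>Pow {..<n}.
        pfaffian (submatrix \<Theta> ({..<n} - S) ({..<n} - S)) * bra (indicator_bits n S) w))"

definition pfaffian_gate_under :: "gate \<Rightarrow> (complex^2^2) list \<Rightarrow> bool" where
  "pfaffian_gate_under X Ms \<longleftrightarrow> has_arity (length Ms) X \<and>
     (\<exists>\<alpha>. \<exists>\<Xi> \<in> carrier_mat (length Ms) (length Ms).
        skew_symmetric \<Xi> \<and> gate_action Ms X = (\<lambda>w. \<alpha> * sPf \<Xi> w))"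

text \<open>The list \<open>Ns\<close> is applied as it stands; the inverses are taken where the predicate is used.\<close>

definition pfaffian_cogate_under :: "cogate \<Rightarrow> (complex^2^2) list \<Rightarrow> bool" where
  "pfaffian_cogate_under X Ns \<longleftrightarrow> has_arity (length Ns) X \<and>
     (\<exists>\<beta>. \<exists>\<Theta> \<in> carrier_mat (length Ns) (length Ns).
        skew_symmetric \<Theta> \<and> cogate_action Ns X = (\<lambda>w. \<beta> * sPf_dual \<Theta> w))"

definition CNOT12 :: gate where
  "CNOT12 = (\<lambda>w. ket [0,0,0,0] w + ket [1,0,1,0] w + ket [1,1,0,1] w + ket [0,1,1,1] w)"

definition CNOT1 :: gate where
  "CNOT1 = (\<lambda>w. ket [0,0,0,0] w + ket [0,1,1,0] w + ket [1,0,1,1] w + ket [1,1,0,1] w)"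

definition bridge_T :: cogate where
  "bridge_T = (\<lambda>w. bra [1,0,0] w + bra [0,1,0] w + bra [0,0,1] w + bra [1,1,1] w)"

definition bridge_U :: cogate where
  "bridge_U = (\<lambda>w. bra [0,0,0] w + bra [0,1,0] w + bra [1,0,1] w)"

end

theory Submission
  imports Defs
begin

text \<open>
  A tensor of arity 4 with coefficient 1 at \<open>0000\<close> is some \<open>sPf \<Xi>\<close> exactly if the coefficients of
  odd weight vanish and the coefficient at \<open>1111\<close> is the Pfaffian of the coefficients of
  weight 2 (the matchgate identity), because the weight 2 gives \<open>\<Xi>\<close>. A dual tensor of arity 3
  with a nonzero coefficient at \<open>111\<close> has no identity to satisfy: the coefficients of weight 1
  are arbitrary, and those of even weight must vanish. The halves of these criteria that produce
  a matrix are \<open>arity_4_multiple_of_sPf\<close> and \<open>arity_3_multiple_of_sPf_dual\<close>; what remains is to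
  find the bases.

  CNOT12 is the sum of the \<open>|a, b, a+b, b\<rangle>\<close>. Hadamard matrices on the target wires 1 and 3 turn it
  into twice the sum of the \<open>(-1)^(k b) |k, b, k, b\<rangle>\<close>, which satisfies the criterion. CNOT1 is the
  sum of the \<open>|p, q, q+p, p\<rangle>\<close>; after the same step its equal wires are nested instead of
  crossing, and the matchgate identity fails by a sign that no diagonal rescaling can repair.
  Instead, CNOT1 as given is transformed by \<open>g = ((1, \<i>), (\<i>, 1))\<close> on the wires 1 and 2 and by
  \<open>((1, -1), (1, 1))\<close> on wire 4. The two halves \<open>p = 0\<close> and \<open>p = 1\<close> then have parts of either
  parity, and the odd parts of the halves cancel.

  Each bridge is a sum of two product tensors. With \<open>u = \<langle>0| + \<langle>1|\<close> and \<open>v = \<langle>0| - \<langle>1|\<close>,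
  twice \<open>T\<close> is \<open>u\<otimes>u\<otimes>u - v\<otimes>v\<otimes>v\<close>, and
  \<open>U = \<langle>0|\<otimes>u\<otimes>\<langle>0| + \<langle>1|\<otimes>\<langle>0|\<otimes>\<langle>1|\<close>. Suppose that the
  changes of basis on the outer wires take the outer factors of the first summand to nonzero
  multiples of \<open>(1, s)\<close> and \<open>(1, t)\<close>, and those of the second to nonzero multiples of \<open>(1, -s)\<close> and \<open>(1, -t)\<close>. Then
  the even parts of the two outer products are proportional, and so are the odd parts, whence the
  free basis on the middle wire can be chosen to cancel all coefficients of even weight. For \<open>T\<close>
  this applies to the identity and to \<open>g\<close>, because \<open>u\<close> and \<open>v\<close> are left eigenvectors of
  the inverse of \<open>g\<close>; for \<open>U\<close> it applies to the Hadamard matrix and to \<open>g\<close>, because the rows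
  of the inverse of \<open>g\<close> are multiples of \<open>(1, -\<i>)\<close> and \<open>(1, \<i>)\<close>. So the same \<open>g\<close> serves
  CNOT1 and both bridges.
\<close>

section \<open>Low-order Pfaffians\<close>

lemma skew_symmetric_entry:
  assumes "skew_symmetric A" "A \<in> carrier_mat n n" "i < n" "j < n"
  shows "A $$ (j, i) = - A $$ (i, j)"
proof -
  have "transpose_mat A $$ (i, j) = (- A) $$ (i, j)"
    using assms(1) by (simp add: skew_symmetric_def)
  then show ?thesis
    using assms by simp
qed

lemma skew_symmetric_of_upper_triangle:
  "skew_symmetric (Matrix.mat n n
     (\<lambda>(i, j). if i < j then z i j else if j < i then - z j i else 0))"
  unfolding skew_symmetric_def by (auto intro!: eq_matI)

lemma pfaffian_odd: "odd (dim_row A) \<Longrightarrow> pfaffian A = 0"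
  by (simp add: pfaffian_def)

lemma pfaffian_empty: "dim_row A = 0 \<Longrightarrow> pfaffian A = 1"
  by (simp add: pfaffian_def)

lemma pfaffian_size_2:
  assumes "dim_row A = 2" "A $$ (1, 0) = - A $$ (0, 1)"
  shows "pfaffian A = A $$ (0, 1)"
proof -
  have s: "{..<2::nat} = {0, 1}" by auto
  have f: "finite {1::nat}" "0 \<notin> {1::nat}" by auto
  have "(\<Sum>p | p permutes {..<2::nat}. of_int (sign p) * (\<Prod>k<1. A $$ (p (2 * k), p (2 * k + 1))))
     = 2 * A $$ (0, 1)"
    unfolding s sum_over_permutations_insert[OF f] permutes_sing
    using assms(2) by (simp add: sign_swap_id sign_id)
  then show ?thesis
    using assms(1) by (simp add: pfaffian_def)
qed

lemma pfaffian_size_4: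
  assumes dim: "dim_row A = 4"
    and skew: "\<And>i j. i < 4 \<Longrightarrow> j < 4 \<Longrightarrow> A $$ (j, i) = - A $$ (i, j)"
  shows "pfaffian A =
    A $$ (0, 1) * A $$ (2, 3) - A $$ (0, 2) * A $$ (1, 3) + A $$ (0, 3) * A $$ (1, 2)"
proof -
  have s: "{..<4::nat} = {0, 1, 2, 3}" by auto
  have f: "finite {1::nat, 2, 3}" "0 \<notin> {1::nat, 2, 3}" "finite {2::nat, 3}" "1 \<notin> {2::nat, 3}"
    "finite {3::nat}" "2 \<notin> {3::nat}" by auto
  have low: "A $$ (1, 0) = - A $$ (0, 1)" "A $$ (2, 0) = - A $$ (0, 2)"
    "A $$ (3, 0) = - A $$ (0, 3)" "A $$ (2, 1) = - A $$ (1, 2)"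
    "A $$ (3, 1) = - A $$ (1, 3)" "A $$ (3, 2) = - A $$ (2, 3)"
    by (rule skew; simp)+
  have m: "(\<Prod>k<2. A $$ (p (2 * k), p (2 * k + 1))) =
      A $$ (p 0, p 1) * A $$ (p 2, p 3)" for p :: "nat \<Rightarrow> nat"
    by (simp add: numeral_eq_Suc)
  \<comment> \<open>Each of the three perfect matchings comes from 8 of the 24 permutations.\<close>
  have "(\<Sum>p | p permutes {..<4::nat}. of_int (sign p) * (\<Prod>k<2. A $$ (p (2 * k), p (2 * k + 1))))
     = 8 * (A $$ (0, 1) * A $$ (2, 3) - A $$ (0, 2) * A $$ (1, 3) + A $$ (0, 3) * A $$ (1, 2))"
    unfolding s m sum_over_permutations_insert[OF f(1,2)] sum_over_permutations_insert[OF f(3,4)]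
      sum_over_permutations_insert[OF f(5,6)] permutes_sing
    by (simp add: sign_swap_id permutation_swap_id
        sign_compose sign_id permutation_compose Transposition.transpose_def low[simplified] algebra_simps)
  then show ?thesis
    using dim by (simp add: pfaffian_def fact_numeral)
qed

section \<open>Coordinates of the subPfaffian tensors\<close>

lemma indicator_bits_inj:
  assumes "S \<subseteq> {..<n}" "T \<subseteq> {..<n}" "indicator_bits n S = indicator_bits n T"
  shows "S = T"
proof -
  have "i \<in> S \<longleftrightarrow> i \<in> T" if "i < n" for i
  proof -
    have "indicator_bits n S ! i = indicator_bits n T ! i" using assms(3) by simp
    then show ?thesis using that by (auto simp: indicator_bits_def split: if_splits)
  qed
  then show ?thesis using assms(1,2) by blast
qed

lemma length_indicator_bits [simp]: "length (indicator_bits n S) = n"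
  by (simp add: indicator_bits_def)

lemma bit_cases: "(b::2) = 0 \<or> b = 1"
  using exhaust_2[of b] by auto

lemma all_bits: "(\<forall>b::2. P b) \<longleftrightarrow> P 0 \<and> P 1"
  using bit_cases by metis

lemma indicator_bits_surj:
  assumes "length w = n"
  obtains S where "S \<subseteq> {..<n}" "w = indicator_bits n S"
proof
  show "{i. i < n \<and> w ! i = 1} \<subseteq> {..<n}" by auto
  show "w = indicator_bits n {i. i < n \<and> w ! i = 1}"
    using assms bit_cases by (intro nth_equalityI) (auto simp: indicator_bits_def)
qed

lemma count_list_indicator_bits:
  assumes "S \<subseteq> {..<n}"
  shows "count_list (indicator_bits n S) 1 = card S"
proof -
  have "{i. i < length (indicator_bits n S) \<and> 1 = indicator_bits n S ! i} = S"
    using assms by (auto simp: indicator_bits_def split: if_splits)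
  then show ?thesis
    unfolding count_list_eq_length_filter length_filter_conv_card by simp
qed

lemma sPf_indicator_bits:
  assumes "\<Xi> \<in> carrier_mat n n" "S \<subseteq> {..<n}"
  shows "sPf \<Xi> (indicator_bits n S) = pfaffian (submatrix \<Xi> S S)"
proof -
  have eq: "indicator_bits n S = indicator_bits n T \<longleftrightarrow> T = S" if "T \<in> Pow {..<n}" for T
    using indicator_bits_inj[OF assms(2), of T] that by auto
  have "sPf \<Xi> (indicator_bits n S) =
      (\<Sum>T\<in>Pow {..<n}. if T = S then pfaffian (submatrix \<Xi> T T) else 0)"
    using assms(1) eq unfolding sPf_def Let_def ket_def
    by (intro sum.cong) auto
  also have "\<dots> = pfaffian (submatrix \<Xi> S S)"
    using assms(2) by simp
  finally show ?thesis .
qed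

lemma sPf_dual_indicator_bits:
  assumes "\<Theta> \<in> carrier_mat n n" "S \<subseteq> {..<n}"
  shows "sPf_dual \<Theta> (indicator_bits n S) = pfaffian (submatrix \<Theta> ({..<n} - S) ({..<n} - S))"
proof -
  have eq: "indicator_bits n S = indicator_bits n T \<longleftrightarrow> T = S" if "T \<in> Pow {..<n}" for T
    using indicator_bits_inj[OF assms(2), of T] that by auto
  have "sPf_dual \<Theta> (indicator_bits n S) =
      (\<Sum>T\<in>Pow {..<n}. if T = S then pfaffian (submatrix \<Theta> ({..<n} - T) ({..<n} - T)) else 0)"
    using assms(1) eq unfolding sPf_dual_def Let_def bra_def
    by (intro sum.cong) auto
  also have "\<dots> = pfaffian (submatrix \<Theta> ({..<n} - S) ({..<n} - S))"
    using assms(2) by simp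
  finally show ?thesis .
qed

lemma sPf_wrong_length: "length w \<noteq> dim_row \<Xi> \<Longrightarrow> sPf \<Xi> w = 0"
  by (auto simp: sPf_def Let_def ket_def intro!: sum.neutral)

lemma sPf_dual_wrong_length: "length w \<noteq> dim_row \<Theta> \<Longrightarrow> sPf_dual \<Theta> w = 0"
  by (auto simp: sPf_dual_def Let_def bra_def intro!: sum.neutral)

lemma dim_row_principal_submatrix:
  assumes "A \<in> carrier_mat n n" "S \<subseteq> {..<n}"
  shows "dim_row (submatrix A S S) = card S"
proof -
  have "{i. i < n \<and> i \<in> S} = S" using assms(2) by auto
  then show ?thesis using assms(1) by (simp add: dim_submatrix)
qed

lemma submatrix_full:
  assumes "A \<in> carrier_mat n n"
  shows "submatrix A {..<n} {..<n} = A"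
proof (rule eq_matI)
  fix i j assume ij: "i < dim_row A" "j < dim_col A"
  have "{a \<in> {..<n}. a < k} = {..<k}" if "k < n" for k using that by auto
  then show "submatrix A {..<n} {..<n} $$ (i, j) = A $$ (i, j)"
    using submatrix_index_card[of i A j "{..<n}" "{..<n}"] ij assms by simp
qed (use assms in \<open>auto simp: dim_submatrix\<close>)

lemma pfaffian_submatrix_pair:
  assumes A: "A \<in> carrier_mat n n" "skew_symmetric A" and ij: "i < j" "j < n"
  shows "pfaffian (submatrix A {i, j} {i, j}) = A $$ (i, j)"
proof -
  have c: "card {a \<in> {i, j}. a < i} = 0" "card {a \<in> {i, j}. a < j} = 1"
  proof -
    have "{a \<in> {i, j}. a < i} = {}" "{a \<in> {i, j}. a < j} = {i}" using ij by auto
    then show "card {a \<in> {i, j}. a < i} = 0" "card {a \<in> {i, j}. a < j} = 1" by simp_all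
  qed
  have "submatrix A {i, j} {i, j} $$ (0, 1) = A $$ (i, j)"
    using submatrix_index_card[of i A j "{i, j}" "{i, j}"] A(1) ij unfolding c by simp
  moreover have "submatrix A {i, j} {i, j} $$ (1, 0) = A $$ (j, i)"
    using submatrix_index_card[of j A i "{i, j}" "{i, j}"] A(1) ij unfolding c by simp
  moreover have "dim_row (submatrix A {i, j} {i, j}) = 2"
    using dim_row_principal_submatrix[OF A(1), of "{i, j}"] ij by simp
  ultimately show ?thesis
    using pfaffian_size_2 skew_symmetric_entry[OF A(2,1), of i j] ij by simp
qed

lemma card_2_ordered:
  assumes "card (S :: nat set) = 2"
  obtains i j where "i < j" "S = {i, j}"
proof -
  obtain x y where "S = {x, y}" "x \<noteq> y" using assms by (auto simp: card_2_iff)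
  then show thesis using that[of x y] that[of y x] by (cases x y rule: linorder_cases) auto
qed

section \<open>Recognising Pfaffian gates and cogates\<close>

text \<open>
  The factor must be the coefficient \<open>c\<close> at \<open>0000\<close>, where \<open>sPf\<close> is 1, and then the entry of \<open>\<Xi>\<close>
  at \<open>(i, j)\<close> must be the coefficient at the pair \<open>{i, j}\<close> divided by \<open>c\<close>. The only even
  weight left is that of \<open>1111\<close>, whose coefficient is \<open>c\<close> times the Pfaffian of \<open>\<Xi>\<close> by the
  matchgate identity.
\<close>

lemma arity_4_multiple_of_sPf:
  assumes arity: "has_arity 4 X"
    and parity: "\<And>w. length w = 4 \<Longrightarrow> odd (count_list w 1) \<Longrightarrow> X w = 0"
    and nz: "X [0,0,0,0] \<noteq> 0"
    and matchgate: "X [0,0,0,0] * X [1,1,1,1] =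
      X [1,1,0,0] * X [0,0,1,1] - X [1,0,1,0] * X [0,1,0,1] + X [1,0,0,1] * X [0,1,1,0]"
  shows "\<exists>\<alpha>. \<exists>\<Xi> \<in> carrier_mat 4 4. skew_symmetric \<Xi> \<and> X = (\<lambda>w. \<alpha> * sPf \<Xi> w)"
proof -
  define c where "c = X [0,0,0,0]"
  define z where "z i j = X (indicator_bits 4 {i, j}) / c" for i j
  define \<Xi> where "\<Xi> = Matrix.mat 4 4
    (\<lambda>(i, j). if i < j then z i j else if j < i then - z j i else 0)"
  have \<Xi>: "\<Xi> \<in> carrier_mat 4 4" "skew_symmetric \<Xi>"
    unfolding \<Xi>_def using skew_symmetric_of_upper_triangle by auto
  have upper: "\<Xi> $$ (i, j) = z i j" if "i < j" "j < 4" for i j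
    using that by (simp add: \<Xi>_def)
  have c: "c \<noteq> 0" "X (indicator_bits 4 {}) = c"
    using nz by (simp_all add: c_def indicator_bits_def upt_rec)
  have "X w = c * sPf \<Xi> w" for w
  proof (cases "length w = 4")
    case False
    then show ?thesis using arity \<Xi>(1) by (simp add: has_arity_def sPf_wrong_length)
  next
    case True
    then obtain S where S: "S \<subseteq> {..<4}" "w = indicator_bits 4 S"
      by (rule indicator_bits_surj)
    have sPf: "sPf \<Xi> w = pfaffian (submatrix \<Xi> S S)"
      unfolding S(2) by (rule sPf_indicator_bits[OF \<Xi>(1) S(1)])
    have dim: "dim_row (submatrix \<Xi> S S) = card S"
      by (rule dim_row_principal_submatrix[OF \<Xi>(1) S(1)])
    have fin: "finite S" and "card S \<le> 4"
      using S(1) finite_subset card_mono[OF _ S(1)] by auto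
    show ?thesis
    proof (cases "odd (card S)")
      case True
      then show ?thesis
        using parity[of w] S(2) count_list_indicator_bits[OF S(1)]
        unfolding sPf by (simp add: dim pfaffian_odd)
    next
      case False
      then have "card S = 0 \<or> card S = 2 \<or> card S = 4"
        using \<open>card S \<le> 4\<close> by presburger
      then consider "S = {}" | "card S = 2" | "S = {..<4}"
        using fin card_subset_eq[OF finite_lessThan S(1)] by fastforce
      then show ?thesis
      proof cases
        case 1
        then show ?thesis using dim S(2) c unfolding sPf by (simp add: pfaffian_empty)
      next
        case 2
        then obtain i j where ij: "i < j" "S = {i, j}" by (rule card_2_ordered)
        then have "pfaffian (submatrix \<Xi> S S) = z i j"
          using pfaffian_submatrix_pair[OF \<Xi> ij(1)] upper S(1) by simp
        then show ?thesis using c S(2) ij unfolding sPf by (simp add: z_def)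
      next
        case 3
        have "pfaffian \<Xi> = z 0 1 * z 2 3 - z 0 2 * z 1 3 + z 0 3 * z 1 2"
          using pfaffian_size_4[OF _ skew_symmetric_entry[OF \<Xi>(2,1)]] \<Xi>(1) by (simp add: upper)
        also have "\<dots> = (X [1,1,0,0] * X [0,0,1,1] - X [1,0,1,0] * X [0,1,0,1]
            + X [1,0,0,1] * X [0,1,1,0]) / (c * c)"
          unfolding z_def by (simp add: indicator_bits_def upt_rec diff_divide_distrib add_divide_distrib)
        also have "\<dots> = X [1,1,1,1] / c"
          unfolding matchgate[symmetric] using c by (simp add: c_def)
        finally show ?thesis
          using c S(2) 3 submatrix_full[OF \<Xi>(1)] unfolding sPf by (simp add: indicator_bits_def upt_rec)
      qed
    qed
  qed
  then show ?thesis using \<Xi> by (intro exI[of _ c] bexI[of _ \<Xi>]) auto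
qed

text \<open>
  The dual tensor indexes a coefficient by the complement of the rows kept, so the empty Pfaffian
  sits at \<open>111\<close> and the entry at \<open>(i, j)\<close> sits at the bitstring supported on the
  remaining position. In size 3 no principal submatrix has a larger Pfaffian to match.
\<close>

lemma arity_3_multiple_of_sPf_dual:
  assumes arity: "has_arity 3 X"
    and parity: "\<And>w. length w = 3 \<Longrightarrow> even (count_list w 1) \<Longrightarrow> X w = 0"
    and nz: "X [1,1,1] \<noteq> 0"
  shows "\<exists>\<beta>. \<exists>\<Theta> \<in> carrier_mat 3 3. skew_symmetric \<Theta> \<and> X = (\<lambda>w. \<beta> * sPf_dual \<Theta> w)"
proof -
  define c where "c = X [1,1,1]"
  define z where "z i j = X (indicator_bits 3 ({..<3} - {i, j})) / c" for i j
  define \<Theta> where "\<Theta> = Matrix.mat 3 3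
    (\<lambda>(i, j). if i < j then z i j else if j < i then - z j i else 0)"
  have \<Theta>: "\<Theta> \<in> carrier_mat 3 3" "skew_symmetric \<Theta>"
    unfolding \<Theta>_def using skew_symmetric_of_upper_triangle by auto
  have upper: "\<Theta> $$ (i, j) = z i j" if "i < j" "j < 3" for i j
    using that by (simp add: \<Theta>_def)
  have c: "c \<noteq> 0" "X (indicator_bits 3 {..<3}) = c"
    using nz by (simp_all add: c_def indicator_bits_def upt_rec)
  have "X w = c * sPf_dual \<Theta> w" for w
  proof (cases "length w = 3")
    case False
    then show ?thesis using arity \<Theta>(1) by (simp add: has_arity_def sPf_dual_wrong_length)
  next
    case True
    then obtain S where S: "S \<subseteq> {..<3}" "w = indicator_bits 3 S"
      by (rule indicator_bits_surj)
    \<comment> \<open>\<open>R\<close> is the set of rows whose Pfaffian is the coefficient at \<open>w\<close>.\<close>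
    define R where "R = {..<3} - S"
    have R: "R \<subseteq> {..<3}" "S = {..<3} - R" "finite R" using S(1) by (auto simp: R_def)
    have sPf: "sPf_dual \<Theta> w = pfaffian (submatrix \<Theta> R R)"
      unfolding S(2) R_def by (rule sPf_dual_indicator_bits[OF \<Theta>(1) S(1)])
    have dim: "dim_row (submatrix \<Theta> R R) = card R"
      by (rule dim_row_principal_submatrix[OF \<Theta>(1) R(1)])
    have card: "card R + card S = 3"
      using card_Diff_subset[of S "{..<3}"] S(1) card_mono[OF _ S(1)] finite_subset[OF S(1)]
      by (simp add: R_def)
    show ?thesis
    proof (cases "odd (card R)")
      case True
      then have "even (card S)" using card by presburger
      with True show ?thesis
        using parity[of w] S(2) count_list_indicator_bits[OF S(1)]
        unfolding sPf by (simp add: dim pfaffian_odd)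
    next
      case False
      then have "card R = 0 \<or> card R = 2"
        using card by presburger
      then consider "R = {}" | "card R = 2"
        using R(3) by auto
      then show ?thesis
      proof cases
        case 1
        then show ?thesis using dim S(2) R(2) c unfolding sPf by (simp add: pfaffian_empty)
      next
        case 2
        then obtain i j where ij: "i < j" "R = {i, j}" by (rule card_2_ordered)
        then have "pfaffian (submatrix \<Theta> R R) = z i j"
          using pfaffian_submatrix_pair[OF \<Theta> ij(1)] upper R(1) by simp
        then show ?thesis using c S(2) R(2) ij unfolding sPf by (simp add: z_def)
      qed
    qed
  qed
  then show ?thesis using \<Theta> by (intro exI[of _ c] bexI[of _ \<Theta>]) auto
qed

section \<open>Changes of basis\<close>

lemma finite_bitstrings: "finite {v :: 2 list. length v = n}"
  using finite_lists_length_eq[of "UNIV :: 2 set" n] by simp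

lemma gate_action_ket:
  "length v = length Ms \<Longrightarrow> length w = length Ms \<Longrightarrow>
    gate_action Ms (ket v) w = (\<Prod>i<length Ms. (Ms ! i) $ (w ! i) $ (v ! i))"
  using finite_bitstrings by (simp add: gate_action_def ket_def if_distrib cong: if_cong)

lemma gate_action_add:
  "gate_action Ms (\<lambda>w. X w + Y w) = (\<lambda>w. gate_action Ms X w + gate_action Ms Y w)"
  by (auto simp: gate_action_def algebra_simps sum.distrib)

lemma cogate_action_bra:
  "length v = length Ms \<Longrightarrow> length w = length Ms \<Longrightarrow>
    cogate_action Ms (bra v) w = (\<Prod>i<length Ms. (Ms ! i) $ (v ! i) $ (w ! i))"
  using finite_bitstrings by (simp add: cogate_action_def bra_def if_distrib cong: if_cong)

lemma cogate_action_add: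
  "cogate_action Ms (\<lambda>w. X w + Y w) = (\<lambda>w. cogate_action Ms X w + cogate_action Ms Y w)"
  by (auto simp: cogate_action_def algebra_simps sum.distrib)

lemma gate_action_CNOT12:
  "gate_action [A, B, C, D] CNOT12 [a, b, c, d] =
     A$a$0 * B$b$0 * C$c$0 * D$d$0 + A$a$1 * B$b$0 * C$c$1 * D$d$0 +
     A$a$1 * B$b$1 * C$c$0 * D$d$1 + A$a$0 * B$b$1 * C$c$1 * D$d$1"
  unfolding CNOT12_def gate_action_add
  by (simp add: gate_action_ket lessThan_Suc numeral_eq_Suc mult_ac)

lemma gate_action_CNOT1:
  "gate_action [A, B, C, D] CNOT1 [a, b, c, d] =
     A$a$0 * B$b$0 * C$c$0 * D$d$0 + A$a$0 * B$b$1 * C$c$1 * D$d$0 +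
     A$a$1 * B$b$0 * C$c$1 * D$d$1 + A$a$1 * B$b$1 * C$c$0 * D$d$1"
  unfolding CNOT1_def gate_action_add
  by (simp add: gate_action_ket lessThan_Suc numeral_eq_Suc mult_ac)

lemma cogate_action_bridge_T:
  "cogate_action [A, B, C] bridge_T [a, b, c] =
     A$1$a * B$0$b * C$0$c + A$0$a * B$1$b * C$0$c +
     A$0$a * B$0$b * C$1$c + A$1$a * B$1$b * C$1$c"
  unfolding bridge_T_def cogate_action_add
  by (simp add: cogate_action_bra lessThan_Suc numeral_eq_Suc mult_ac)

lemma cogate_action_bridge_U:
  "cogate_action [A, B, C] bridge_U [a, b, c] =
     A$0$a * B$0$b * C$0$c + A$0$a * B$1$b * C$0$c + A$1$a * B$0$b * C$1$c"
  unfolding bridge_U_def cogate_action_add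
  by (simp add: cogate_action_bra lessThan_Suc numeral_eq_Suc mult_ac)

lemma pfaffian_gate_under_arity_4:
  fixes A B C D :: "complex^2^2" and X :: gate
  defines "Y \<equiv> \<lambda>a b c d. gate_action [A, B, C, D] X [a, b, c, d]"
  assumes "has_arity 4 X"
    and parity: "\<And>a b c d. odd (count_list [a, b, c, d] 1) \<Longrightarrow> Y a b c d = 0"
    and "Y 0 0 0 0 \<noteq> 0"
    and "Y 0 0 0 0 * Y 1 1 1 1 = Y 1 1 0 0 * Y 0 0 1 1 - Y 1 0 1 0 * Y 0 1 0 1 + Y 1 0 0 1 * Y 0 1 1 0"
  shows "pfaffian_gate_under X [A, B, C, D]"
proof -
  have "has_arity 4 (gate_action [A, B, C, D] X)"
    by (simp add: has_arity_def gate_action_def)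
  moreover have "gate_action [A, B, C, D] X w = 0"
    if w: "length w = 4" "odd (count_list w 1)" for w
  proof -
    obtain a b c d where "w = [a, b, c, d]"
      using w(1) by (auto simp: length_Suc_conv numeral_eq_Suc)
    then show ?thesis using parity w(2) by (simp add: Y_def)
  qed
  ultimately have "\<exists>\<alpha>. \<exists>\<Xi> \<in> carrier_mat 4 4. skew_symmetric \<Xi> \<and>
      gate_action [A, B, C, D] X = (\<lambda>w. \<alpha> * sPf \<Xi> w)"
    using assms(4,5) unfolding Y_def by (rule arity_4_multiple_of_sPf)
  moreover have "length [A, B, C, D] = 4" by simp
  ultimately show ?thesis
    using assms(2) unfolding pfaffian_gate_under_def by metis
qed

lemma pfaffian_cogate_under_arity_3:
  fixes A B C :: "complex^2^2" and X :: cogate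
  defines "Y \<equiv> \<lambda>a b c. cogate_action [A, B, C] X [a, b, c]"
  assumes "has_arity 3 X"
    and parity: "\<And>a b c. even (count_list [a, b, c] 1) \<Longrightarrow> Y a b c = 0"
    and "Y 1 1 1 \<noteq> 0"
  shows "pfaffian_cogate_under X [A, B, C]"
proof -
  have "has_arity 3 (cogate_action [A, B, C] X)"
    by (simp add: has_arity_def cogate_action_def)
  moreover have "cogate_action [A, B, C] X w = 0"
    if w: "length w = 3" "even (count_list w 1)" for w
  proof -
    obtain a b c where "w = [a, b, c]"
      using w(1) by (auto simp: length_Suc_conv numeral_eq_Suc)
    then show ?thesis using parity w(2) by (simp add: Y_def)
  qed
  ultimately have "\<exists>\<beta>. \<exists>\<Theta> \<in> carrier_mat 3 3. skew_symmetric \<Theta> \<and>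
      cogate_action [A, B, C] X = (\<lambda>w. \<beta> * sPf_dual \<Theta> w)"
    using assms(4) unfolding Y_def by (rule arity_3_multiple_of_sPf_dual)
  moreover have "length [A, B, C] = 3" by simp
  ultimately show ?thesis
    using assms(2) unfolding pfaffian_cogate_under_def by metis
qed

text \<open>
  The rows are listed in the order of the bits 0 and 1. In the type of bits \<open>2 = 0\<close>, so
  a literal built with \<^const>\<open>vector\<close> would put the entry at 1 before the entry at 0.
\<close>

definition mat22 :: "complex \<Rightarrow> complex \<Rightarrow> complex \<Rightarrow> complex \<Rightarrow> complex^2^2" where
  "mat22 a b c d = (\<chi> i j. if i = 0 then (if j = 0 then a else b) else (if j = 0 then c else d))"

lemma mat22_nth [simp]:
  "mat22 a b c d $ 0 $ 0 = a" "mat22 a b c d $ 0 $ 1 = b"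
  "mat22 a b c d $ 1 $ 0 = c" "mat22 a b c d $ 1 $ 1 = d"
  by (simp_all add: mat22_def)

lemma mat22_inverse:
  assumes "a * d - b * c = \<Delta>" "\<Delta> \<noteq> 0"
  shows "invertible (mat22 a b c d)"
    and "matrix_inv (mat22 a b c d) = mat22 (d / \<Delta>) (- b / \<Delta>) (- c / \<Delta>) (a / \<Delta>)"
proof -
  let ?M = "mat22 a b c d" and ?N = "mat22 (d / \<Delta>) (- b / \<Delta>) (- c / \<Delta>) (a / \<Delta>)"
  have \<Delta>: "(a * d - b * c) / \<Delta> = 1" using assms by simp
  have inv: "?M ** ?N = Finite_Cartesian_Product.mat 1" "?N ** ?M = Finite_Cartesian_Product.mat 1"
    unfolding Finite_Cartesian_Product.vec_eq_iff all_bits using \<Delta>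
    by (simp_all add: matrix_matrix_mult_def Finite_Cartesian_Product.mat_def mat22_def
        sum_2 diff_divide_distrib algebra_simps)
  then show "invertible ?M" unfolding invertible_def by blast
  have "?M ** matrix_inv ?M = Finite_Cartesian_Product.mat 1 \<and>
        matrix_inv ?M ** ?M = Finite_Cartesian_Product.mat 1"
    unfolding matrix_inv_def by (rule someI[of _ ?N]) (use inv in blast)
  then have "matrix_inv ?M = matrix_inv ?M ** (?M ** ?N)"
    using inv by simp
  then show "matrix_inv ?M = ?N"
    using \<open>?M ** matrix_inv ?M = _ \<and> _\<close> by (simp add: matrix_mul_assoc)
qed

theorem theorem9:
  shows "\<exists>A B C D E F G H I J :: complex^2^2.
    (\<forall>M \<in> {A, B, C, D, E, F, G, H, I, J}. invertible M) \<and>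
    pfaffian_gate_under CNOT12 [A, B, C, D] \<and>
    pfaffian_gate_under CNOT1 [G, H, I, J] \<and>
    pfaffian_cogate_under bridge_T [matrix_inv D, matrix_inv E, matrix_inv G] \<and>
    pfaffian_cogate_under bridge_U [matrix_inv C, matrix_inv F, matrix_inv H]"
proof -
  define h where "h = mat22 1 1 1 (- 1)"
  define e where "e = mat22 1 0 0 1"
  define g where "g = mat22 1 \<i> \<i> 1"
  \<comment> \<open>Let \<open>K = |00\<rangle> + |11\<rangle>\<close> and \<open>L = |01\<rangle> + |10\<rangle>\<close> on the wires 2 and 3 of CNOT1. The
    factors there of its halves, \<open>K\<close> and \<open>L\<close>, become \<open>K + \<i> L\<close> and \<open>\<i> K + L\<close>. If \<open>P\<close> and \<open>Q\<close> are
    the images of \<open>|00\<rangle>\<close> and \<open>|11\<rangle>\<close> on the wires 1 and 4, all odd coefficients vanish once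
    \<open>P + \<i> Q\<close> is even and \<open>P - \<i> Q\<close> is odd. The matrix \<open>j\<close> on wire 4 achieves this.\<close>
  define j where "j = mat22 1 (- 1) 1 1"
  \<comment> \<open>The outer factors of \<open>T\<close> become \<open>u \<otimes> (1 - \<i>) u\<close> and \<open>v \<otimes> (1 + \<i>) v\<close> up to a common
    factor, so the inverse of \<open>E\<close> must send \<open>u\<close> to \<open>(\<i>, -\<i>)\<close> and \<open>v\<close> to \<open>(1, 1)\<close>, up to
    scale: the even parts then cancel against middle bit 0, the odd parts against middle bit 1.\<close>
  define E where "E = mat22 1 (- \<i>) \<i> (- 1)"
  \<comment> \<open>The outer factors of \<open>U\<close> become \<open>(1, 1) \<otimes> (1, -\<i>)\<close> and \<open>-\<i> (1, -1) \<otimes> (1, \<i>)\<close> up to a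
    common factor, so the inverse of \<open>F\<close> must send \<open>u\<close> to \<open>(\<i>, -\<i>)\<close> and \<open>\<langle>0|\<close> to \<open>(1, 1)\<close>,
    up to scale.\<close>
  define F where "F = mat22 (1 + \<i>) 1 (\<i> - 1) (- 1)"
  have h: "invertible h" "matrix_inv h = mat22 (1/2) (1/2) (1/2) (- 1/2)"
    using mat22_inverse[of 1 "- 1" 1 1 "- 2"] by (simp_all add: h_def)
  have e: "invertible e" "matrix_inv e = mat22 1 0 0 1"
    using mat22_inverse[of 1 1 0 0 1] by (simp_all add: e_def)
  have g: "invertible g" "matrix_inv g = mat22 (1/2) (- \<i>/2) (- \<i>/2) (1/2)"
    using mat22_inverse[of 1 1 \<i> \<i> 2] by (simp_all add: g_def)
  have j: "invertible j"
    using mat22_inverse[of 1 1 "- 1" 1 2] by (simp_all add: j_def)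
  have E: "invertible E" "matrix_inv E = mat22 (1/2) (- \<i>/2) (\<i>/2) (- 1/2)"
    using mat22_inverse[of 1 "- 1" "- \<i>" \<i> "- 2"] by (simp_all add: E_def)
  have F: "invertible F"
    "matrix_inv F = mat22 (- 1 / (- 2 * \<i>)) (- 1 / (- 2 * \<i>)) (- (\<i> - 1) / (- 2 * \<i>)) ((1 + \<i>) / (- 2 * \<i>))"
    using mat22_inverse[of "1 + \<i>" "- 1" 1 "\<i> - 1" "- 2 * \<i>"] by (simp_all add: F_def)
  have "pfaffian_gate_under CNOT12 [h, e, h, e]"
  proof (rule pfaffian_gate_under_arity_4)
    show "has_arity 4 CNOT12"
      by (auto simp: has_arity_def CNOT12_def ket_def)
    have "\<forall>a b c d. odd (count_list [a, b, c, d] 1) \<longrightarrow>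
        gate_action [h, e, h, e] CNOT12 [a, b, c, d] = 0"
      unfolding gate_action_CNOT12 all_bits by (simp add: h_def e_def)
    then show "odd (count_list [a, b, c, d] 1) \<Longrightarrow>
        gate_action [h, e, h, e] CNOT12 [a, b, c, d] = 0" for a b c d by blast
  qed (simp_all add: gate_action_CNOT12 h_def e_def)
  moreover have "pfaffian_gate_under CNOT1 [g, g, e, j]"
  proof (rule pfaffian_gate_under_arity_4)
    show "has_arity 4 CNOT1"
      by (auto simp: has_arity_def CNOT1_def ket_def)
    have "\<forall>a b c d. odd (count_list [a, b, c, d] 1) \<longrightarrow>
        gate_action [g, g, e, j] CNOT1 [a, b, c, d] = 0"
      unfolding gate_action_CNOT1 all_bits by (simp add: g_def e_def j_def)
    then show "odd (count_list [a, b, c, d] 1) \<Longrightarrow>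
        gate_action [g, g, e, j] CNOT1 [a, b, c, d] = 0" for a b c d by blast
  qed (simp_all add: gate_action_CNOT1 g_def e_def j_def)
  moreover have "pfaffian_cogate_under bridge_T [matrix_inv e, matrix_inv E, matrix_inv g]"
  proof (rule pfaffian_cogate_under_arity_3)
    show "has_arity 3 bridge_T"
      by (auto simp: has_arity_def bridge_T_def bra_def)
    have "\<forall>a b c. even (count_list [a, b, c] 1) \<longrightarrow>
        cogate_action [matrix_inv e, matrix_inv E, matrix_inv g] bridge_T [a, b, c] = 0"
      unfolding cogate_action_bridge_T all_bits e E g by simp
    then show "even (count_list [a, b, c] 1) \<Longrightarrow>
        cogate_action [matrix_inv e, matrix_inv E, matrix_inv g] bridge_T [a, b, c] = 0"
      for a b c by blast
  qed (simp add: cogate_action_bridge_T e E g)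
  moreover have "pfaffian_cogate_under bridge_U [matrix_inv h, matrix_inv F, matrix_inv g]"
  proof (rule pfaffian_cogate_under_arity_3)
    show "has_arity 3 bridge_U"
      by (auto simp: has_arity_def bridge_U_def bra_def)
    have "\<forall>a b c. even (count_list [a, b, c] 1) \<longrightarrow>
        cogate_action [matrix_inv h, matrix_inv F, matrix_inv g] bridge_U [a, b, c] = 0"
      unfolding cogate_action_bridge_U all_bits h F g by (simp add: field_simps)
    then show "even (count_list [a, b, c] 1) \<Longrightarrow>
        cogate_action [matrix_inv h, matrix_inv F, matrix_inv g] bridge_U [a, b, c] = 0"
      for a b c by blast
  qed (simp add: cogate_action_bridge_U h F g field_simps)
  ultimately have "(\<forall>M \<in> {h, e, h, e, E, F, g, g, e, j}. invertible M) \<and>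
    pfaffian_gate_under CNOT12 [h, e, h, e] \<and>
    pfaffian_gate_under CNOT1 [g, g, e, j] \<and>
    pfaffian_cogate_under bridge_T [matrix_inv e, matrix_inv E, matrix_inv g] \<and>
    pfaffian_cogate_under bridge_U [matrix_inv h, matrix_inv F, matrix_inv g]"
    using h(1) e(1) g(1) j E(1) F(1) by simp
  then show ?thesis
    by (intro exI)
qed

end
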